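(* Let $h\geq 4$ be an integer, let $n=2^h$, and let $\overline{\Gamma_{2^h}}=\overline{C_{2^h}(1,2,2^2,\ldots,2^{h-1})}$ be the complement of the circulant graph $C_{2^h}(1,2,2^2,\ldots,2^{h-1})$. Then its distance spectral radius is $$\rho(\overline{\Gamma_{2^h}})=n+2h-2.$$
   Context: For $S\subseteq\mathbb{Z}_n\setminus\{0\}$, the circulant graph $C_n(S)$ is the simple undirected graph with vertex set $\mathbb{Z}_n=\{0,1,\ldots,n-1\}$ and edge set $\{\{g,g+s\}: g\in\mathbb{Z}_n, s\in S\}$ (addition mod $n$); $C_n(s_1,\ldots,s_t)$ means $C_n(\{s_1,\ldots,s_t\})$. $\overline{\Gamma}$ denotes the complement of $\Gamma$. For a connected graph $\Gamma$ with vertices $v_1,\ldots,v_n$, the distance matrix $\mathbf{D}(\Gamma)$ is the $n\times n$ matrix with $(i,j)$-entry $d_{\Gamma}(v_i,v_j)$, the length of a shortest path between $v_i$ and $v_j$ ($0$ if $i=j$). The distance spectral radius $\rho(\Gamma)$ is the largest eigenvalue of $\mathbf{D}(\Gamma)$. *)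

theory Defs
  imports
    "Graph_Theory.Graph_Theory"
    "Jordan_Normal_Form.Spectral_Radius"
begin

text \<open>
  Simple undirected graphs are represented as in \<^theory>\<open>Graph_Theory.Pair_Digraph\<close>, by
  irreflexive symmetric arc relations: an edge \<open>{u, v}\<close> is the pair of arcs \<open>(u, v)\<close>, \<open>(v, u)\<close>.
  The residues modulo \<open>n\<close> are the naturals below \<open>n\<close>, so that they also index
  the rows and columns of matrices.
\<close>

definition circulant_graph :: "nat \<Rightarrow> nat set \<Rightarrow> nat pair_pre_digraph" where
  "circulant_graph n S = \<lparr> pverts = {0..<n},
     parcs = (\<Union>g\<in>{0..<n}. \<Union>s\<in>S. {(g, (g + s) mod n), ((g + s) mod n, g)}) \<rparr>"

definition graph_complement :: "'a pair_pre_digraph \<Rightarrow> 'a pair_pre_digraph" where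
  "graph_complement G = \<lparr> pverts = pverts G,
     parcs = {(u, v). u \<in> pverts G \<and> v \<in> pverts G \<and> u \<noteq> v \<and> (u, v) \<notin> parcs G} \<rparr>"

lemma pair_graph_circulant_graph:
  assumes "S \<subseteq> {1..<n}"
  shows "pair_graph (circulant_graph n S)"
proof
  have fin: "finite S"
    using assms finite_subset by blast
  have neq: "(g + s) mod n \<noteq> g" if "g < n" "s \<in> S" for g s
  proof
    assume "(g + s) mod n = g"
    moreover have "0 < s" "s < n"
      using that assms by auto
    ultimately show False
      using \<open>g < n\<close> by (cases "g + s < n") (simp_all add: mod_if split: if_splits)
  qed
  show "finite (pverts (circulant_graph n S))" "finite (parcs (circulant_graph n S))"
    using fin by (auto simp: circulant_graph_def)
  show "symmetric (with_proj (circulant_graph n S))"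
    by (auto simp: symmetric_def sym_def circulant_graph_def)
  fix e assume e: "e \<in> parcs (circulant_graph n S)"
  then show "fst e \<in> pverts (circulant_graph n S)" "snd e \<in> pverts (circulant_graph n S)"
    by (auto simp: circulant_graph_def)
  from e show "fst e \<noteq> snd e"
    using neq by (auto simp: circulant_graph_def) metis+
qed

lemma pair_graph_graph_complement:
  assumes "pair_graph G"
  shows "pair_graph (graph_complement G)"
proof -
  interpret pair_graph G by fact
  have "parcs (graph_complement G) \<subseteq> pverts G \<times> pverts G"
    by (auto simp: graph_complement_def)
  then have "finite (parcs (graph_complement G))"
    by (rule finite_subset) (simp add: pair_finite_verts)
  then show ?thesis
    using pair_finite_verts pair_sym_arcs
    by unfold_locales (auto simp: graph_complement_def symmetric_def sym_def)
qed

text \<open>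
  The distance is the library's shortest-path cost for unit arc weights. It is \<open>\<infinity>\<close>
  between different components, where the conversion to the reals yields the meaningless value \<open>0\<close>.
\<close>

definition graph_dist :: "'a pair_pre_digraph \<Rightarrow> 'a \<Rightarrow> 'a \<Rightarrow> real" where
  "graph_dist G u v = real_of_ereal (wf_digraph.\<mu> (with_proj G) (\<lambda>_. 1) u v)"

lemma (in pair_wf_digraph) graph_dist_shortest_path:
  assumes "u \<rightarrow>\<^sup>*\<^bsub>with_proj G\<^esub> v"
  shows "\<exists>p. apath u p v \<and> graph_dist G u v = real (length p) \<and>
    (\<forall>q. apath u q v \<longrightarrow> length p \<le> length q)"
proof -
  have cost: "awalk_cost (\<lambda>_. 1) p = real (length p)" for p :: "('a \<times> 'a) list"
    by (induct p) auto
  from assms obtain p0 where "apath u p0 v"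
    using reachable_apath by auto
  then obtain p where p: "apath u p v" "\<forall>q. apath u q v \<longrightarrow> length p \<le> length q"
    using ex_has_least_nat[of "\<lambda>p. apath u p v" p0 length] by auto
  have min: "length p \<le> length q" if "awalk u q v" for q
  proof -
    have "apath u (awalk_to_apath q) v"
      using that by (rule apath_awalk_to_apath)
    moreover have "length (awalk_to_apath q) \<le> length q"
      using that
    proof (induct rule: awalk_to_apath_induct)
      case (path p)
      then have "awalk_to_apath p = p"
        by (auto simp: awalk_to_apath.simps)
      then show ?case by simp
    next
      case (decomp p q r s)
      then have "p = q @ r @ s"
        using awalk_cyc_decomp_has_prop[of u p v] by auto
      with decomp show ?case
        using step_awalk_to_apath[of u p v q r s] by simp
    qed
    ultimately show ?thesis using p(2) le_trans by blast
  qed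
  have "\<mu> (\<lambda>_. 1) u v = ereal (real (length p))"
  proof (rule antisym)
    show "\<mu> (\<lambda>_. 1) u v \<le> ereal (real (length p))"
      using min_cost_le_walk_cost[of u p v "\<lambda>_. 1"] p(1) by (simp add: cost apath_def)
    show "ereal (real (length p)) \<le> \<mu> (\<lambda>_. 1) u v"
      unfolding \<mu>_def by (rule INF_greatest) (auto simp: cost min)
  qed
  then have "graph_dist G u v = real (length p)"
    by (simp add: graph_dist_def)
  with p show ?thesis by blast
qed

text \<open>For a connected graph whose vertices are the naturals below its order.\<close>

definition distance_matrix :: "nat pair_pre_digraph \<Rightarrow> real mat" where
  "distance_matrix G = mat (card (pverts G)) (card (pverts G)) (\<lambda>(i, j). graph_dist G i j)"

text \<open>
  Distance matrices are real and symmetric, so all their eigenvalues are real and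
  \<open>spectrum\<close> over the reals loses none of them.
\<close>

definition distance_spectral_radius :: "nat pair_pre_digraph \<Rightarrow> real" where
  "distance_spectral_radius G = Max (spectrum (distance_matrix G))"

end

theory Submission
  imports Defs
begin

text \<open>
  Write \<open>\<Gamma>\<close> for the circulant graph of the powers of two below \<open>n = 2 ^ h\<close>. The neighbours of a
  vertex are its translates by the residues \<open>\<plusminus>2 ^ i\<close>. For \<open>i < h - 1\<close> these are
  distinct and come in pairs, while \<open>2 ^ (h - 1)\<close> is its own negative, so \<open>\<Gamma>\<close> is regular of
  degree \<open>k = 2 * h - 1\<close> (\<open>card_powers_of_2_and_negatives\<close>).

  This degree is so small that \<open>2 * k < n\<close> once \<open>h \<ge> 4\<close>. Hence the neighbourhoods in \<open>\<Gamma>\<close>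
  of two adjacent vertices \<open>u\<close>, \<open>v\<close> do not cover all vertices, and since these neighbourhoods
  contain \<open>v\<close> and \<open>u\<close> themselves, any vertex outside them is a common neighbour of \<open>u\<close> and \<open>v\<close>
  in the complement (\<open>common_nonneighbour\<close>). So the complement is connected, with distance 1
  between vertices that are not adjacent in \<open>\<Gamma>\<close> and distance 2 between those that are
  (\<open>graph_dist_complement\<close>).

  Every row of the distance matrix therefore consists of one 0, of \<open>k\<close> entries 2 and of
  \<open>n - 1 - k\<close> entries 1, and has sum \<open>n - 1 + k = n + 2 * h - 2\<close>. For a nonnegative matrix with
  constant row sums this sum is the largest eigenvalue, attained at the all-ones vector
  (\<open>Max_spectrum_eq_row_sum\<close>).
\<close>

section \<open>The largest eigenvalue of a nonnegative matrix with constant row sums\<close>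

lemma row_sum_mult_all_ones:
  fixes A :: "real mat"
  assumes A: "A \<in> carrier_mat n n"
    and rows: "\<And>i. i < n \<Longrightarrow> (\<Sum>j<n. A $$ (i, j)) = r"
  shows "A *\<^sub>v vec n (\<lambda>_. 1) = r \<cdot>\<^sub>v vec n (\<lambda>_. 1)"
  using A rows by (intro eq_vecI) (auto simp: scalar_prod_def atLeast0LessThan)

text \<open>
  In the row where an eigenvector has an entry of largest modulus \<open>m\<close>, the eigenvalue equation
  bounds \<open>\<bar>k\<bar> * m\<close> by the row sum times \<open>m\<close>.
\<close>

lemma eigenvalue_le_row_sum:
  fixes A :: "real mat"
  assumes A: "A \<in> carrier_mat n n"
    and nonneg: "\<And>i j. i < n \<Longrightarrow> j < n \<Longrightarrow> 0 \<le> A $$ (i, j)"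
    and rows: "\<And>i. i < n \<Longrightarrow> (\<Sum>j<n. A $$ (i, j)) = r"
    and k: "eigenvalue A k"
  shows "k \<le> r"
proof -
  from k A obtain v where v: "v \<in> carrier_vec n" "v \<noteq> 0\<^sub>v n" "A *\<^sub>v v = k \<cdot>\<^sub>v v"
    by (auto simp: eigenvalue_def eigenvector_def)
  then obtain l where l: "l < n" "v $ l \<noteq> 0"
    by (metis carrier_vecD eq_vecI index_zero_vec)
  define m where "m = Max ((\<lambda>j. \<bar>v $ j\<bar>) ` {..<n})"
  have le_m: "\<bar>v $ j\<bar> \<le> m" if "j < n" for j
    using that by (simp add: m_def)
  have "m \<in> (\<lambda>j. \<bar>v $ j\<bar>) ` {..<n}"
    unfolding m_def using l by (intro Max_in) auto
  then obtain i where i: "i < n" "m = \<bar>v $ i\<bar>"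
    by auto
  have "0 < m"
    using le_m[OF l(1)] l(2) by linarith
  have "k * v $ i = (A *\<^sub>v v) $ i"
    using v i by simp
  also have "\<dots> = (\<Sum>j<n. A $$ (i, j) * v $ j)"
    using A v(1) i by (auto simp: scalar_prod_def atLeast0LessThan)
  finally have "\<bar>k\<bar> * m = \<bar>\<Sum>j<n. A $$ (i, j) * v $ j\<bar>"
    using i by (simp flip: abs_mult)
  also have "\<dots> \<le> (\<Sum>j<n. A $$ (i, j) * m)"
    using nonneg le_m i(1)
    by (intro order_trans[OF sum_abs] sum_mono) (simp add: abs_mult mult_left_mono)
  also have "\<dots> = r * m"
    using rows i by (simp flip: sum_distrib_right)
  finally show ?thesis
    using \<open>0 < m\<close> by simp
qed

lemma Max_spectrum_eq_row_sum:
  fixes A :: "real mat"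
  assumes A: "A \<in> carrier_mat n n" and "0 < n"
    and nonneg: "\<And>i j. i < n \<Longrightarrow> j < n \<Longrightarrow> 0 \<le> A $$ (i, j)"
    and rows: "\<And>i. i < n \<Longrightarrow> (\<Sum>j<n. A $$ (i, j)) = r"
  shows "Max (spectrum A) = r"
proof (rule Max_eqI)
  show "finite (spectrum A)"
    by (rule card_finite_spectrum[OF A])
  show "k \<le> r" if "k \<in> spectrum A" for k
    using eigenvalue_le_row_sum[OF A nonneg rows] that by (simp add: spectrum_def)
  have "vec n (\<lambda>_. 1) \<noteq> (0\<^sub>v n :: real vec)"
    using \<open>0 < n\<close> by (auto dest!: arg_cong[where f = "\<lambda>v. v $ 0"])
  then have "eigenvector A (vec n (\<lambda>_. 1)) r"
    using A row_sum_mult_all_ones[OF A rows] by (simp add: eigenvector_def)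
  then show "r \<in> spectrum A"
    by (auto simp: spectrum_def eigenvalue_def)
qed

section \<open>Distances at most two\<close>

lemma (in pair_wf_digraph) graph_dist_self:
  assumes "u \<in> pverts G"
  shows "graph_dist G u u = 0"
proof -
  have "apath u [] u"
    using assms by (simp add: apath_Nil_iff)
  then show ?thesis
    using graph_dist_shortest_path[of u u] assms by auto
qed

lemma (in pair_wf_digraph) graph_dist_eq_1:
  assumes "(u, v) \<in> parcs G" "u \<noteq> v"
  shows "graph_dist G u v = 1"
proof -
  have uv: "u \<in> pverts G" "v \<in> pverts G"
    using assms wellformed' by auto
  have "u \<rightarrow>\<^sup>*\<^bsub>with_proj G\<^esub> v"
    using assms by (intro reachable_adjI) simp
  then obtain p where p: "apath u p v" "graph_dist G u v = real (length p)"
      "\<And>q. apath u q v \<Longrightarrow> length p \<le> length q"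
    using graph_dist_shortest_path by blast
  have "apath u [(u, v)] v"
    using assms uv by (simp add: apath_simps)
  from p(3)[OF this] have "length p \<le> 1"
    by simp
  moreover have "p \<noteq> []"
    using p(1) assms by (auto simp: apath_simps)
  ultimately have "length p = 1"
    by (cases p) auto
  then show ?thesis
    using p(2) by simp
qed

lemma (in pair_wf_digraph) graph_dist_eq_2:
  assumes "u \<noteq> v" "(u, v) \<notin> parcs G" "(u, w) \<in> parcs G" "(w, v) \<in> parcs G"
  shows "graph_dist G u v = 2"
proof -
  have vs: "u \<in> pverts G" "v \<in> pverts G" "w \<in> pverts G"
    using assms wellformed' by auto
  have "u \<rightarrow>\<^sup>*\<^bsub>with_proj G\<^esub> w" "w \<rightarrow>\<^sup>*\<^bsub>with_proj G\<^esub> v"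
    using assms by (auto intro!: reachable_adjI)
  then have "u \<rightarrow>\<^sup>*\<^bsub>with_proj G\<^esub> v"
    by (rule reachable_trans)
  then obtain p where p: "apath u p v" "graph_dist G u v = real (length p)"
      "\<And>q. apath u q v \<Longrightarrow> length p \<le> length q"
    using graph_dist_shortest_path by blast
  have "w \<noteq> u" "w \<noteq> v"
    using assms by auto
  then have "apath u [(u, w), (w, v)] v"
    using assms vs by (auto simp: apath_simps)
  from p(3)[OF this] have "length p \<le> 2"
    by simp
  moreover have "p \<noteq> []"
    using p(1) assms by (auto simp: apath_simps)
  moreover have "length p \<noteq> 1"
    using p(1) assms by (auto simp: length_Suc_conv apath_simps)
  ultimately have "length p = 2"
    by (cases p rule: remdups_adj.cases) auto
  then show ?thesis
    using p(2) by simp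
qed

section \<open>Complements of sparse regular graphs\<close>

text \<open>
  The union of the neighbourhoods of \<open>u\<close> and \<open>v\<close> has at most \<open>2 * k\<close> elements, so it misses some
  vertex \<open>w\<close>. Because \<open>u\<close> and \<open>v\<close> are adjacent, each lies in the neighbourhood of the other, so
  counting already excludes \<open>w = u\<close> and \<open>w = v\<close>.
\<close>

lemma (in pair_graph) common_nonneighbour:
  assumes regular: "\<And>u. u \<in> pverts G \<Longrightarrow> card (parcs G `` {u}) = k"
    and sparse: "2 * k < card (pverts G)"
    and arc: "(u, v) \<in> parcs G"
  obtains w where "w \<in> pverts G" "w \<noteq> u" "w \<noteq> v" "(u, w) \<notin> parcs G" "(w, v) \<notin> parcs G"
proof -
  let ?N = "parcs G `` {u} \<union> parcs G `` {v}"
  have sym: "(b, a) \<in> parcs G" if "(a, b) \<in> parcs G" for a b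
    using that pair_sym_arcs by (auto simp: symmetric_def dest: symD)
  have "u \<in> pverts G" "v \<in> pverts G"
    using arc wellformed' by auto
  then have "card ?N \<le> 2 * k"
    using card_Un_le[of "parcs G `` {u}" "parcs G `` {v}"] by (simp add: regular)
  moreover have "finite ?N"
    using pair_finite_arcs by (auto intro: finite_Image)
  ultimately have "\<not> pverts G \<subseteq> ?N"
    using sparse card_mono[of ?N "pverts G"] by linarith
  then obtain w where "w \<in> pverts G" "w \<notin> ?N"
    by blast
  moreover have "u \<in> ?N" "v \<in> ?N"
    using arc sym by auto
  ultimately show ?thesis
    using that sym by blast
qed

lemma graph_dist_complement:
  assumes G: "pair_graph G"
    and regular: "\<And>u. u \<in> pverts G \<Longrightarrow> card (parcs G `` {u}) = k"
    and sparse: "2 * k < card (pverts G)"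
    and uv: "u \<in> pverts G" "v \<in> pverts G"
  shows "graph_dist (graph_complement G) u v =
    (if u = v then 0 else if (u, v) \<in> parcs G then 2 else 1)"
proof -
  interpret G: pair_graph G by fact
  interpret C: pair_graph "graph_complement G"
    by (rule pair_graph_graph_complement) fact
  consider "u = v" | "u \<noteq> v" "(u, v) \<notin> parcs G" | "u \<noteq> v" "(u, v) \<in> parcs G"
    by blast
  then show ?thesis
  proof cases
    case 1
    then show ?thesis
      using uv C.graph_dist_self[of u] by (simp add: graph_complement_def)
  next
    case 2
    then have "(u, v) \<in> parcs (graph_complement G)"
      using uv by (simp add: graph_complement_def)
    then show ?thesis
      using 2 C.graph_dist_eq_1 by simp
  next
    case 3
    obtain w where "w \<in> pverts G" "w \<noteq> u" "w \<noteq> v" "(u, w) \<notin> parcs G" "(w, v) \<notin> parcs G"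
      using G.common_nonneighbour[OF regular sparse 3(2)] by blast
    then have "(u, w) \<in> parcs (graph_complement G)" "(w, v) \<in> parcs (graph_complement G)"
      using uv by (auto simp: graph_complement_def)
    moreover have "(u, v) \<notin> parcs (graph_complement G)"
      using 3 by (simp add: graph_complement_def)
    ultimately show ?thesis
      using 3 C.graph_dist_eq_2[of u v w] by simp
  qed
qed

lemma connected_complement:
  assumes G: "pair_graph G"
    and regular: "\<And>u. u \<in> pverts G \<Longrightarrow> card (parcs G `` {u}) = k"
    and sparse: "2 * k < card (pverts G)"
  shows "Digraph_Component.connected (with_proj (graph_complement G))"
proof -
  interpret G: pair_graph G by fact
  interpret C: pair_graph "graph_complement G"
    by (rule pair_graph_graph_complement) fact
  have arcI: "a \<rightarrow>\<^sup>*\<^bsub>with_proj (graph_complement G)\<^esub> b"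
    if "a \<in> pverts G" "b \<in> pverts G" "a \<noteq> b" "(a, b) \<notin> parcs G" for a b
    using that by (intro C.reachable_adjI) (simp add: graph_complement_def)
  have "u \<rightarrow>\<^sup>*\<^bsub>with_proj (graph_complement G)\<^esub> v" if uv: "u \<in> pverts G" "v \<in> pverts G" for u v
  proof (cases "(u, v) \<in> parcs G")
    case True
    obtain w where "w \<in> pverts G" "w \<noteq> u" "w \<noteq> v" "(u, w) \<notin> parcs G" "(w, v) \<notin> parcs G"
      using G.common_nonneighbour[OF regular sparse True] by blast
    then show ?thesis
      using uv by (intro C.reachable_trans[OF arcI arcI]) auto
  next
    case False
    then show ?thesis
      using uv arcI C.reachable_refl[of u] by (cases "u = v") (simp_all add: graph_complement_def)
  qed
  moreover have "pverts G \<noteq> {}"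
    using sparse by auto
  ultimately show ?thesis
    unfolding Digraph_Component.connected_def
    by (intro strongly_connectedI C.reachable_mk_symmetricI) (simp_all add: graph_complement_def)
qed

lemma distance_spectral_radius_complement:
  assumes G: "pair_graph G" and verts: "pverts G = {0..<n}"
    and regular: "\<And>u. u < n \<Longrightarrow> card (parcs G `` {u}) = k"
    and sparse: "2 * k < n"
  shows "distance_spectral_radius (graph_complement G) = real n + real k - 1"
proof -
  interpret G: pair_graph G by fact
  let ?D = "distance_matrix (graph_complement G)"
  have dist: "graph_dist (graph_complement G) u v =
      (if u = v then 0 else if (u, v) \<in> parcs G then 2 else 1)" if "u < n" "v < n" for u v
    using that by (intro graph_dist_complement[OF G, of k]) (simp_all add: verts regular sparse)
  have D: "?D \<in> carrier_mat n n"
    by (simp add: distance_matrix_def graph_complement_def verts)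
  have entry: "?D $$ (i, j) = (if i = j then 0 else if (i, j) \<in> parcs G then 2 else 1)"
    if "i < n" "j < n" for i j
    using that dist by (simp add: distance_matrix_def graph_complement_def verts)
  have "(\<Sum>j<n. ?D $$ (i, j)) = real n + real k - 1" if i: "i < n" for i
  proof -
    have nbrs: "{..<n} \<inter> {j. (i, j) \<in> parcs G} = parcs G `` {i}"
      using G.wellformed'(2) verts by auto
    \<comment> \<open>An entry is 1, plus 1 at each of the \<open>k\<close> neighbours, minus 1 on the diagonal.\<close>
    have "(\<Sum>j<n. ?D $$ (i, j)) =
        (\<Sum>j<n. 1 + of_bool ((i, j) \<in> parcs G) - of_bool (j = i))"
      using i G.pair_no_loops[of "(i, i)"] by (intro sum.cong) (auto simp: entry)
    also have "\<dots> = real n + real (card (parcs G `` {i})) - 1"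
      using i by (simp add: sum.distrib sum_subtractf sum.delta of_bool_def
        sum.If_cases nbrs)
    finally show ?thesis
      using i regular by simp
  qed
  then show ?thesis
    unfolding distance_spectral_radius_def
    using sparse entry by (intro Max_spectrum_eq_row_sum[OF D]) auto
qed

section \<open>Degrees in circulant graphs\<close>

text \<open>
  The arcs of a circulant graph are the forward arcs and their reversals. A backward step by \<open>s\<close>
  is a forward step by \<open>n - s\<close>, so neighbourhoods are translates of \<open>S\<close> together with its
  negatives.
\<close>

lemma circulant_graph_neighbours:
  assumes S: "S \<subseteq> {1..<n}" and "u < n"
  shows "parcs (circulant_graph n S) `` {u} = (\<lambda>s. (u + s) mod n) ` (S \<union> (\<lambda>s. n - s) ` S)"
proof -
  have "u = (v + s) mod n \<longleftrightarrow> v = (u + (n - s)) mod n" if "v < n" "s \<in> S" for v s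
  proof -
    have "1 \<le> s" "s < n"
      using S that(2) by auto
    with that \<open>u < n\<close> show ?thesis
      by (auto simp: mod_if)
  qed
  then show ?thesis
    using \<open>u < n\<close> by (auto simp: circulant_graph_def image_iff) fastforce+
qed

lemma circulant_graph_degree:
  assumes S: "S \<subseteq> {1..<n}" and u: "u < n"
  shows "card (parcs (circulant_graph n S) `` {u}) = card (S \<union> (\<lambda>s. n - s) ` S)"
proof -
  have "inj_on (\<lambda>s. (u + s) mod n) {0..<n}"
    using u by (auto simp: inj_on_def mod_if split: if_splits)
  moreover have "S \<union> (\<lambda>s. n - s) ` S \<subseteq> {0..<n}"
    using S by fastforce
  ultimately show ?thesis
    unfolding circulant_graph_neighbours[OF S u] by (metis card_image inj_on_subset)
qed

text \<open>
  The negative of \<open>2 ^ (h - 1)\<close> is that power itself. The other \<open>h - 1\<close> negatives are new, because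
  they exceed \<open>2 ^ (h - 1)\<close>.
\<close>

lemma card_powers_of_2_and_negatives:
  assumes "0 < h"
  shows "card ({2 ^ i | i. i < h} \<union> (\<lambda>s. 2 ^ h - s) ` {2 ^ i | i. i < h} :: nat set) = 2 * h - 1"
proof -
  obtain m where h: "h = Suc m"
    using assms by (cases h) auto
  let ?P = "(\<lambda>i. 2 ^ i) ` {..<h} :: nat set" and ?Q = "(\<lambda>i. 2 ^ h - 2 ^ i) ` {..<m} :: nat set"
  have less: "(2::nat) ^ i < 2 ^ m" if "i < m" for i
    using that by simp
  have "{2 ^ i | i. i < h} \<union> (\<lambda>s. 2 ^ h - s) ` {2 ^ i | i. i < h} = ?P \<union> ?Q"
    by (auto simp: h less_Suc_eq)
  moreover have "card ?P = h"
    by (subst card_image) (auto simp: inj_on_def)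
  moreover have "card ?Q = m"
  proof (subst card_image)
    show "inj_on (\<lambda>i. 2 ^ h - 2 ^ i :: nat) {..<m}"
    proof (rule inj_onI)
      fix i j assume "i \<in> {..<m}" "j \<in> {..<m}" "(2 ^ h - 2 ^ i :: nat) = 2 ^ h - 2 ^ j"
      then have "(2::nat) ^ i = 2 ^ j"
        using less[of i] less[of j] unfolding h power_Suc lessThan_iff by linarith
      then show "i = j"
        by simp
    qed
  qed simp
  moreover have "?P \<inter> ?Q = {}"
  proof -
    have "2 ^ i \<noteq> (2 ^ h - 2 ^ j :: nat)" if "i < h" "j < m" for i j
    proof -
      have "(2::nat) ^ i \<le> 2 ^ m"
        using that by (simp add: h)
      then show ?thesis
        using less[OF that(2)] unfolding h power_Suc by linarith
    qed
    then show ?thesis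
      by auto
  qed
  ultimately show ?thesis
    by (simp add: card_Un_disjoint h)
qed

section \<open>The complement of the circulant graph of the powers of two\<close>

lemma four_mult_le_power_2:
  fixes h :: nat
  assumes "4 \<le> h"
  shows "4 * h \<le> 2 ^ h"
  using assms by (induct h rule: dec_induct) auto

theorem theorem5p3:
  fixes h n :: nat
  assumes "h \<ge> 4" and "n = 2 ^ h"
  shows "Digraph_Component.connected (with_proj (graph_complement (circulant_graph n {2 ^ i | i. i < h}))) \<and>
    distance_spectral_radius (graph_complement (circulant_graph n {2 ^ i | i. i < h}))
      = real n + 2 * real h - 2"
proof -
  let ?S = "{2 ^ i | i. i < h} :: nat set"
  let ?G = "circulant_graph n ?S"
  have S: "?S \<subseteq> {1..<n}"
    by (auto simp: assms(2))
  have G: "pair_graph ?G"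
    using S by (rule pair_graph_circulant_graph)
  have verts: "pverts ?G = {0..<n}"
    by (simp add: circulant_graph_def)
  have degree: "card (parcs ?G `` {u}) = 2 * h - 1" if "u < n" for u
    using circulant_graph_degree[OF S that] card_powers_of_2_and_negatives[of h] assms by simp
  have sparse: "2 * (2 * h - 1) < n"
    using four_mult_le_power_2[OF assms(1)] assms by linarith
  have "Digraph_Component.connected (with_proj (graph_complement ?G))"
    by (rule connected_complement[OF G, of "2 * h - 1"]) (use degree sparse in \<open>simp_all add: verts\<close>)
  moreover have "distance_spectral_radius (graph_complement ?G) = real n + real (2 * h - 1) - 1"
    by (rule distance_spectral_radius_complement[OF G verts degree sparse])
  ultimately show ?thesis
    using assms(1) by (simp add: of_nat_diff)
qed

end
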